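(* Let $n,t\in\mathbb N$ with $t<n$, let $F$ be chosen uniformly at random from $\mathcal F(n,t)$, and let $\mathbf D=(d_F(1),\dots,d_F(n))$ be its degree sequence. Throw $n-t-1$ balls independently and uniformly at random into $n$ bins and let $Z_j$ be the load of the $j$-th bin. Independently, let $R$ be uniform on $[t]$ and for $j\in[t]$ set $X_j=1$ if $R=j$ and $X_j=0$ otherwise. Then $$(Z_1+X_1,\dots,Z_t+X_t,Z_{t+1}+1,\dots,Z_n+1)$$ has the same distribution as $\mathbf D$.
   Context: $\mathcal F(n,t)$ is the class of forests on vertex set $[n]$ with exactly $t$ tree components (isolated vertices allowed) such that the vertices $1,\dots,t$ lie in pairwise different components; $d_F(v)$ is the degree of $v$ in $F$. *)

theory Defs
  imports "HOL-Probability.Probability"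
begin

text \<open>
  A finite simple graph on a vertex set \<open>V\<close> is given by its set of edges, an edge being a
  two-element subset of \<open>V\<close>.
\<close>

definition graph_on :: "'a set \<Rightarrow> 'a set set \<Rightarrow> bool" where
  "graph_on V E \<longleftrightarrow> (\<forall>e\<in>E. e \<subseteq> V \<and> card e = 2)"

definition vertex_degree :: "'a set set \<Rightarrow> 'a \<Rightarrow> nat" where
  "vertex_degree E v = card {e \<in> E. v \<in> e}"

definition is_cycle :: "'a set set \<Rightarrow> 'a list \<Rightarrow> bool" where
  "is_cycle E c \<longleftrightarrow> length c \<ge> 3 \<and> distinct c \<and>
     (\<forall>i<length c. {c ! i, c ! (Suc i mod length c)} \<in> E)"

definition is_forest :: "'a set \<Rightarrow> 'a set set \<Rightarrow> bool" where
  "is_forest V E \<longleftrightarrow> graph_on V E \<and> (\<nexists>c. is_cycle E c)"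

definition graph_component :: "'a set set \<Rightarrow> 'a \<Rightarrow> 'a set" where
  "graph_component E v = {w. (v, w) \<in> {(x, y). {x, y} \<in> E}\<^sup>*}"

definition graph_components :: "'a set \<Rightarrow> 'a set set \<Rightarrow> 'a set set" where
  "graph_components V E = graph_component E ` V"

text \<open>The class \<open>\<F>(n,t)\<close>; the components of a forest are trees.\<close>

definition forests :: "nat \<Rightarrow> nat \<Rightarrow> nat set set set" where
  "forests n t = {E. is_forest {1..n} E \<and> card (graph_components {1..n} E) = t \<and>
     (\<forall>i\<in>{1..t}. \<forall>j\<in>{1..t}. i \<noteq> j \<longrightarrow> graph_component E i \<noteq> graph_component E j)}"

definition degree_sequence :: "nat \<Rightarrow> nat set set \<Rightarrow> nat list" where
  "degree_sequence n E = map (vertex_degree E) [1..<n+1]"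

text \<open>Ball \<open>i\<close>, for \<open>1 \<le> i \<le> m\<close>, lands in bin \<open>b i\<close>.\<close>

definition throw_balls :: "nat \<Rightarrow> nat \<Rightarrow> (nat \<Rightarrow> nat) pmf" where
  "throw_balls m n = Pi_pmf {1..m} undefined (\<lambda>_. pmf_of_set {1..n})"

definition load :: "nat \<Rightarrow> (nat \<Rightarrow> nat) \<Rightarrow> nat \<Rightarrow> nat" where
  "load m b j = card {i \<in> {1..m}. b i = j}"

text \<open>
  \<^const>\<open>pmf_of_set\<close> is the uniform distribution only on a finite nonempty set; for
  \<open>\<F>(n,t)\<close> this is the case:
\<close>

lemma finite_forests: "finite (forests n t)"
proof (rule finite_subset)
  show "forests n t \<subseteq> Pow (Pow {1..n})"
    by (auto simp: forests_def is_forest_def graph_on_def)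
qed auto

lemma forests_nonempty:
  assumes "1 \<le> t" "t < n"
  shows "forests n t \<noteq> {}"
proof -
  define E where "E = (\<lambda>v. {1::nat, v}) ` {t<..n}"
  have E1: "1 \<in> e" if "e \<in> E" for e using that by (auto simp: E_def)
  have g: "graph_on {1..n} E"
    using assms by (auto simp: graph_on_def E_def)
  have nc: "\<not> is_cycle E c" for c
  proof
    assume "is_cycle E c"
    then have l: "length c \<ge> 3" and d: "distinct c"
      and e: "\<And>i. i < length c \<Longrightarrow> {c ! i, c ! (Suc i mod length c)} \<in> E"
      by (auto simp: is_cycle_def)
    have l0: "0 < length c" "1 < length c" "2 < length c" using l by linarith+
    have a: "c!0 = 1 \<or> c!1 = 1" using E1[OF e[OF l0(1)]] l by auto
    have b: "c!1 = 1 \<or> c!2 = 1" using E1[OF e[OF l0(2)]] l by (auto simp: numeral_2_eq_2)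
    have "c!0 \<noteq> c!2" using d l by (subst nth_eq_iff_index_eq) auto
    with a b have c1: "c!1 = 1" by auto
    have ne: "Suc 2 mod length c \<noteq> 1" using l by (cases "length c = 3") auto
    have "c!2 = 1 \<or> c!(Suc 2 mod length c) = 1" using E1[OF e[OF l0(3)]] l by auto
    moreover have "c!2 \<noteq> c!1" using d l by (subst nth_eq_iff_index_eq) auto
    moreover have "c!(Suc 2 mod length c) \<noteq> c!1"
    proof -
      have "Suc 2 mod length c < length c" using l by (intro mod_less_divisor) auto
      with d l ne show ?thesis by (subst nth_eq_iff_index_eq) auto
    qed
    ultimately show False using c1 by auto
  qed
  let ?r = "{(x, y). {x, y} \<in> E}"
  let ?S = "insert 1 {t<..n}"
  have rS: "y \<in> ?S \<and> x \<in> ?S" if "(x, y) \<in> ?r" for x y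
  proof -
    from that have "{x, y} \<in> E" by simp
    then obtain u where u: "{x, y} = {1, u}" "u \<in> {t<..n}" unfolding E_def by (rule imageE)
    from u(1) have "x = 1 \<and> y = u \<or> x = u \<and> y = 1" by (simp only: doubleton_eq_iff)
    with u(2) show ?thesis by (elim disjE conjE) simp_all
  qed
  have inS: "w \<in> ?S" if "(v, w) \<in> ?r\<^sup>*" "v \<in> ?S" for v w
    using that(1)
  proof (cases rule: rtranclE)
    case base
    then show ?thesis using that(2) by simp
  next
    case (step y)
    show ?thesis using rS[OF step(2)] by (rule conjunct1)
  qed
  have comp1: "graph_component E v = ?S" if v: "v \<in> ?S" for v
  proof
    show "graph_component E v \<subseteq> ?S" unfolding graph_component_def by (intro subsetI, elim CollectE, rule inS[OF _ v])
    have to1: "(v, 1) \<in> ?r\<^sup>*"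
    proof (cases "v = 1")
      case False
      then have "(v, 1) \<in> ?r" using v by (auto simp: E_def insert_commute)
      then show ?thesis by (rule r_into_rtrancl)
    qed simp
    show "?S \<subseteq> graph_component E v"
    proof
      fix w assume w: "w \<in> ?S"
      have "(1, w) \<in> ?r\<^sup>*"
      proof (cases "w = 1")
        case False
        then have "(1, w) \<in> ?r" using w by (auto simp: E_def)
        then show ?thesis by (rule r_into_rtrancl)
      qed simp
      with to1 have "(v, w) \<in> ?r\<^sup>*" by (rule rtrancl_trans)
      then show "w \<in> graph_component E v" unfolding graph_component_def by (rule CollectI)
    qed
  qed
  have comp2: "graph_component E v = {v}" if v: "v \<notin> ?S" for v
  proof -
    have "w = v" if "(v, w) \<in> ?r\<^sup>*" for w
      using that
    proof (cases rule: converse_rtranclE)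
      case base
      then show ?thesis by simp
    next
      case (step y)
      have "v \<in> ?S" using rS[OF step(1)] by (rule conjunct2)
      with v show ?thesis by contradiction
    qed
    then show ?thesis by (auto simp: graph_component_def)
  qed
  have inj: "inj_on (graph_component E) {1..t}"
  proof (rule inj_onI)
    fix i j assume ij: "i \<in> {1..t}" "j \<in> {1..t}" "graph_component E i = graph_component E j"
    have self: "x \<in> graph_component E x" for x by (auto simp: graph_component_def)
    consider "i = 1" "j = 1" | "i = 1" "j \<noteq> 1" | "i \<noteq> 1" "j = 1" | "i \<noteq> 1" "j \<noteq> 1" by auto
    then show "i = j"
    proof cases
      case 2
      then show ?thesis using ij self[of i] comp2[of j] by auto
    next
      case 3
      then show ?thesis using ij self[of j] comp2[of i] by auto
    next
      case 4
      then show ?thesis using ij comp2[of i] comp2[of j] by auto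
    qed auto
  qed
  have "graph_components {1..n} E = graph_component E ` {1..t}"
  proof -
    have "graph_component E v \<in> graph_component E ` {1..t}" if "v \<in> {1..n}" for v
    proof (cases "v \<le> t")
      case False
      then have "graph_component E v = graph_component E 1" using that comp1[of v] comp1[of 1] by auto
      then show ?thesis using assms by auto
    qed (use that in auto)
    moreover have "{1..t} \<subseteq> {1..n}" using assms by auto
    ultimately show ?thesis unfolding graph_components_def by blast
  qed
  then have "card (graph_components {1..n} E) = t"
    using card_image[OF inj] by simp
  moreover have "is_forest {1..n} E" using g nc by (simp add: is_forest_def)
  moreover have "\<forall>i\<in>{1..t}. \<forall>j\<in>{1..t}. i \<noteq> j \<longrightarrow> graph_component E i \<noteq> graph_component E j"
    using inj unfolding inj_on_def by blast
  ultimately have "E \<in> forests n t"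
    unfolding forests_def by (intro CollectI conjI)
  then show ?thesis by (rule ex_in_conv[THEN iffD1, OF exI])
qed

end

theory Submission
  imports Defs
begin

text \<open>
  A forest in \<open>\<F>(n,t)\<close> is a forest rooted at \<open>1,\<dots>,t\<close>. Its Pruefer code is a word of length
  \<open>n - t\<close> over \<open>[n]\<close> whose last letter is a root and in which every vertex occurs as often as it has
  children; a uniform word of this kind is a throw of \<open>n - t - 1\<close> balls followed by \<open>R\<close>. The bijection
  itself is not needed: given a degree sequence \<open>d\<close> and any non-root \<open>v\<close> with \<open>d v = 1\<close>, deleting
  the leaf \<open>v\<close> from the forest and deleting the first letter \<open>u\<close> from the word both replace \<open>d u\<close>
  by \<open>d u - 1\<close>, so the numbers of forests and of words with degree sequence \<open>d\<close> satisfy the same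
  recursion.
\<close>

section \<open>Connected components\<close>

lemma self_in_graph_component: "v \<in> graph_component E v"
  by (simp add: graph_component_def)

lemma graph_component_trans:
  "b \<in> graph_component E a \<Longrightarrow> c \<in> graph_component E b \<Longrightarrow> c \<in> graph_component E a"
  by (auto simp: graph_component_def)

lemma graph_component_edge: "{a, b} \<in> E \<Longrightarrow> b \<in> graph_component E a"
  by (auto simp: graph_component_def)

lemma graph_component_sym:
  assumes "b \<in> graph_component E a" shows "a \<in> graph_component E b"
proof -
  have "sym ({(x, y). {x, y} \<in> E}\<^sup>*)"
    by (intro sym_rtrancl symI) (auto simp: insert_commute)
  then show ?thesis using assms by (auto simp: graph_component_def dest: symD)
qed

lemma graph_component_eq_iff:
  "graph_component E a = graph_component E b \<longleftrightarrow> b \<in> graph_component E a"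
proof
  assume "graph_component E a = graph_component E b"
  then show "b \<in> graph_component E a" by (simp add: self_in_graph_component)
next
  assume b: "b \<in> graph_component E a"
  show "graph_component E a = graph_component E b"
  proof (intro equalityI subsetI)
    fix x assume "x \<in> graph_component E a"
    with graph_component_sym[OF b] show "x \<in> graph_component E b" by (rule graph_component_trans)
  next
    fix x assume "x \<in> graph_component E b"
    with b show "x \<in> graph_component E a" by (rule graph_component_trans)
  qed
qed

lemma graph_component_mono:
  assumes "E \<subseteq> E'" shows "graph_component E v \<subseteq> graph_component E' v"
proof -
  have "{(x, y). {x, y} \<in> E}\<^sup>* \<subseteq> {(x, y). {x, y} \<in> E'}\<^sup>*"
    by (rule rtrancl_mono) (use assms in auto)
  then show ?thesis by (auto simp: graph_component_def)
qed

text \<open>The only edge at \<open>v\<close> leads to \<open>u\<close>, so sending \<open>v\<close>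
  to \<open>u\<close> turns every walk from \<open>a\<close> into a walk in \<open>E\<close>: the
  edge \<open>{u, v}\<close> collapses to a point and all other edges avoid
  \<open>v\<close>.\<close>

lemma graph_component_pendant:
  assumes "\<forall>e\<in>E. v \<notin> e" "u \<noteq> v" "a \<noteq> v" "w \<in> graph_component (insert {u, v} E) a"
  shows "(if w = v then u else w) \<in> graph_component E a"
proof -
  have "(a, w) \<in> {(x, y). {x, y} \<in> insert {u, v} E}\<^sup>*"
    using assms(4) by (simp add: graph_component_def)
  then show ?thesis
  proof (induction rule: rtrancl_induct)
    case base
    then show ?case using assms(3) by (simp add: self_in_graph_component)
  next
    case (step y z)
    from step.hyps(2) consider "{y, z} = {u, v}" | "{y, z} \<in> E" by auto
    then show ?case
    proof cases
      case 1
      then show ?thesis using step.IH assms(2) by (auto simp: doubleton_eq_iff split: if_splits)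
    next
      case 2
      then have "y \<noteq> v" "z \<noteq> v" using assms(1) by auto
      then show ?thesis using step.IH graph_component_trans graph_component_edge[OF 2] by fastforce
    qed
  qed
qed

section \<open>Cycles\<close>

text \<open>As a cycle has at least three vertices, the predecessor and the successor of
  \<open>x\<close> on it differ, hence so do the edges to them. A vertex on a single edge therefore
  lies on no cycle.\<close>

lemma is_cycle_two_edges:
  assumes "is_cycle E c" "x \<in> set c"
  obtains e f where "e \<in> E" "f \<in> E" "x \<in> e" "x \<in> f" "e \<noteq> f"
proof -
  let ?L = "length c"
  have L: "?L \<ge> 3" and d: "distinct c"
    and e: "\<And>i. i < ?L \<Longrightarrow> {c ! i, c ! (Suc i mod ?L)} \<in> E"
    using assms(1) by (auto simp: is_cycle_def)
  obtain i where i: "i < ?L" "x = c ! i" using assms(2) by (auto simp: in_set_conv_nth)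
  \<comment> \<open>The positions cyclically before (\<open>j\<close>) and after (\<open>k\<close>)
    position \<open>i\<close>.\<close>
  define j where "j = (if i = 0 then ?L - 1 else i - 1)"
  define k where "k = Suc i mod ?L"
  have k_eq: "k = (if Suc i = ?L then 0 else Suc i)" using i by (auto simp: k_def)
  have j: "j < ?L" "Suc j mod ?L = i" using i L by (auto simp: j_def)
  have k: "k < ?L" using i by (auto simp: k_eq)
  have ne: "j \<noteq> k" "j \<noteq> i" "k \<noteq> i" using i L by (auto simp: j_def k_eq split: if_splits)
  have "c ! j \<noteq> c ! k" "c ! j \<noteq> c ! i" "c ! k \<noteq> c ! i"
    using ne i j k d by (auto simp: nth_eq_iff_index_eq)
  then have "{c ! i, c ! k} \<noteq> {c ! j, c ! i}" by (auto simp: doubleton_eq_iff)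
  moreover have "{c ! i, c ! k} \<in> E" "{c ! j, c ! i} \<in> E"
    using e[OF i(1)] e[OF j(1)] j(2) by (auto simp: k_def)
  ultimately show thesis using that i by blast
qed

lemma is_cycle_mono: "is_cycle E c \<Longrightarrow> E \<subseteq> E' \<Longrightarrow> is_cycle E' c"
  by (auto simp: is_cycle_def)

lemma finite_graph_on: "finite V \<Longrightarrow> graph_on V E \<Longrightarrow> finite E"
  by (rule finite_subset[of _ "Pow V"]) (auto simp: graph_on_def)

section \<open>Rooted forests and their leaves\<close>

text \<open>Deleting leaves leads out of the vertex sets \<open>{1..n}\<close>, so vertices and
  roots are arbitrary sets. One root per component replaces the count of components and can be
  checked vertex by vertex.\<close>

definition root_forest :: "'a set \<Rightarrow> 'a set \<Rightarrow> 'a set set \<Rightarrow> bool" where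
  "root_forest V R E \<longleftrightarrow> is_forest V E \<and> (\<forall>v\<in>V. \<exists>!r. r \<in> R \<and> r \<in> graph_component E v)"

lemma root_forest_roots_disconnected:
  assumes "root_forest V R E" "R \<subseteq> V" "r \<in> R" "s \<in> R" "s \<in> graph_component E r"
  shows "r = s"
  using assms self_in_graph_component[of r E] unfolding root_forest_def by blast

text \<open>The new vertex is on one edge only, so no cycle passes through it; old vertices reach
  the same roots as before, and \<open>v\<close> shares the component of \<open>u\<close>.\<close>

lemma root_forest_add_leaf:
  assumes P: "root_forest V R E" and v: "v \<notin> V" and u: "u \<in> V" and R: "R \<subseteq> V"
  shows "root_forest (insert v V) R (insert {u, v} E)"
proof -
  let ?E = "insert {u, v} E"
  have g: "graph_on V E" and nc: "\<And>c. \<not> is_cycle E c"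
    and r: "\<And>v. v \<in> V \<Longrightarrow> \<exists>!r. r \<in> R \<and> r \<in> graph_component E v"
    using P by (auto simp: root_forest_def is_forest_def)
  have uv: "u \<noteq> v" using u v by auto
  have vE: "\<forall>e\<in>E. v \<notin> e" using g v by (auto simp: graph_on_def)
  have "graph_on (insert v V) ?E" using g u uv by (auto simp: graph_on_def)
  moreover have "\<not> is_cycle ?E c" for c
  proof
    assume c: "is_cycle ?E c"
    show False
    proof (cases "v \<in> set c")
      case True
      from is_cycle_two_edges[OF c True] show False using vE by (metis insertE)
    next
      case False
      \<comment> \<open>A cycle that avoids \<open>v\<close> does not use \<open>{u, v}\<close>, so
        it is already a cycle in \<open>E\<close>.\<close>
      have "{c ! i, c ! (Suc i mod length c)} \<in> E" if "i < length c" for i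
      proof -
        have "Suc i mod length c < length c" using that by (intro mod_less_divisor) auto
        then have "c ! i \<noteq> v" "c ! (Suc i mod length c) \<noteq> v"
          using False that by (metis nth_mem)+
        then have "{c ! i, c ! (Suc i mod length c)} \<noteq> {u, v}" by (auto simp: doubleton_eq_iff)
        then show ?thesis using c that by (auto simp: is_cycle_def)
      qed
      then show False using nc[of c] c by (auto simp: is_cycle_def)
    qed
  qed
  moreover have *: "\<exists>!r. r \<in> R \<and> r \<in> graph_component ?E w" if w: "w \<in> V" for w
  proof -
    have "r \<in> graph_component ?E w \<longleftrightarrow> r \<in> graph_component E w" if "r \<in> R" for r
    proof -
      have "w \<noteq> v" "r \<noteq> v" using w v that R by auto
      then show ?thesis
        using graph_component_pendant[OF vE uv, of w r] graph_component_mono[of E ?E w] by auto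
    qed
    then show ?thesis using r[OF w] by (metis (no_types, lifting))
  qed
  moreover have "\<exists>!r. r \<in> R \<and> r \<in> graph_component ?E v"
  proof -
    have "graph_component ?E u = graph_component ?E v"
      unfolding graph_component_eq_iff by (rule graph_component_edge) simp
    then show ?thesis using *[OF u] by simp
  qed
  ultimately show ?thesis by (auto simp: root_forest_def is_forest_def)
qed

text \<open>Inverse of attaching a leaf. Because \<open>v\<close> is not a root, no component loses
  its root, and a walk between other vertices can be rerouted around the pendant
  \<open>v\<close>.\<close>

lemma root_forest_remove_leaf:
  assumes P: "root_forest V R E" and v: "v \<in> V" "v \<notin> R" and dv: "vertex_degree E v = 1"
    and R: "R \<subseteq> V"
  obtains u E' where "u \<in> V - {v}" "E = insert {u, v} E'" "\<forall>e\<in>E'. v \<notin> e"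
    "root_forest (V - {v}) R E'"
proof -
  have g: "graph_on V E" and nc: "\<And>c. \<not> is_cycle E c"
    and r: "\<And>v. v \<in> V \<Longrightarrow> \<exists>!r. r \<in> R \<and> r \<in> graph_component E v"
    using P by (auto simp: root_forest_def is_forest_def)
  obtain e where e: "{e \<in> E. v \<in> e} = {e}"
    using dv by (auto simp: vertex_degree_def card_1_singleton_iff)
  then have eE: "e \<in> E" "v \<in> e" by auto
  then have "card e = 2" "e \<subseteq> V" using g by (auto simp: graph_on_def)
  then obtain u where u: "e = {u, v}" "u \<noteq> v"
    using eE(2) by (auto simp: card_2_iff doubleton_eq_iff)
  define E' where "E' = E - {e}"
  have E: "E = insert {u, v} E'" using u eE by (auto simp: E'_def)
  have vE: "\<forall>e\<in>E'. v \<notin> e" using e by (auto simp: E'_def)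
  have "graph_on (V - {v}) E'" using g vE by (auto simp: graph_on_def E'_def)
  moreover have "\<not> is_cycle E' c" for c
    using nc[of c] is_cycle_mono[of E' c E] by (auto simp: E'_def)
  moreover have "\<exists>!r. r \<in> R \<and> r \<in> graph_component E' w" if w: "w \<in> V - {v}" for w
  proof -
    have "r \<in> graph_component E w \<longleftrightarrow> r \<in> graph_component E' w" if "r \<in> R" for r
      using graph_component_pendant[OF vE u(2), of w r] graph_component_mono[of E' E w] w v that
      unfolding E by (auto split: if_splits)
    then show ?thesis using r[of w] w by (metis (no_types, lifting) Diff_iff)
  qed
  ultimately have "root_forest (V - {v}) R E'" by (auto simp: root_forest_def is_forest_def)
  moreover have "u \<in> V - {v}" using u \<open>e \<subseteq> V\<close> by auto
  ultimately show thesis using that E vE by blast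
qed

lemma successively_in_graph_component:
  assumes "successively (\<lambda>x y. {x, y} \<in> E) xs" "xs \<noteq> []" "y \<in> set xs"
  shows "y \<in> graph_component E (hd xs)"
  using assms
proof (induction xs rule: induct_list012)
  case (3 x z zs)
  then show ?case
    using graph_component_trans[OF graph_component_edge, of x z E y]
    by (auto simp: self_in_graph_component)
qed (auto simp: self_in_graph_component)

text \<open>The end of a longest path starting at a root is a leaf, and no root: another root would
  lie in the same component as the start.\<close>

lemma root_forest_leaf_exists:
  assumes P: "root_forest V R E" and fin: "finite V" and R: "R \<subset> V"
  shows "\<exists>v\<in>V - R. vertex_degree E v = 1"
proof -
  have g: "graph_on V E" and nc: "\<And>c. \<not> is_cycle E c"
    and r: "\<And>v. v \<in> V \<Longrightarrow> \<exists>!r. r \<in> R \<and> r \<in> graph_component E v"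
    using P by (auto simp: root_forest_def is_forest_def)
  have edge: "x \<in> V \<and> y \<in> V \<and> x \<noteq> y" if "{x, y} \<in> E" for x y
    using g that by (cases "x = y") (auto simp: graph_on_def)
  \<comment> \<open>Paths are listed with the free end at the head, so that extending one is a
    \<open>#\<close>, and with the root at the end. Length at least 2 gives the head a neighbour on
    the path.\<close>
  define S where "S xs \<longleftrightarrow> distinct xs \<and> set xs \<subseteq> V \<and>
    successively (\<lambda>x y. {x, y} \<in> E) xs \<and> 2 \<le> length xs \<and> last xs \<in> R" for xs
  obtain v where v: "v \<in> V" "v \<notin> R" using R by auto
  obtain s where s: "s \<in> R" "s \<in> graph_component E v" using r[OF v(1)] by auto
  have "(v, s) \<in> {(x, y). {x, y} \<in> E}\<^sup>*" "s \<noteq> v"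
    using s v by (auto simp: graph_component_def)
  \<comment> \<open>The last step of a walk from the non-root \<open>v\<close> to its root
    \<open>s\<close> is an edge at \<open>s\<close>, so a path with two vertices exists. Lengths are
    bounded by \<open>card V\<close>, hence there is a longest one.\<close>
  then obtain y where "{y, s} \<in> E" by (auto elim: rtranclE)
  then have "S [y, s]" using edge[of y s] s by (auto simp: S_def)
  moreover have "length xs < Suc (card V)" if "S xs" for xs
    using that card_mono[OF fin, of "set xs"] by (auto simp: S_def distinct_card)
  ultimately obtain xs where xs: "S xs" "\<And>ys. S ys \<Longrightarrow> length ys \<le> length xs"
    using ex_has_greatest_nat[of S "[y, s]" length "Suc (card V)"] by auto
  then obtain w p ys where xs_eq: "xs = w # p # ys"
    by (cases xs; cases "tl xs") (auto simp: S_def)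
  have wp: "{w, p} \<in> E" using xs(1) by (auto simp: S_def xs_eq)
  have w: "w \<in> V" using xs(1) by (auto simp: S_def xs_eq)
  have "w \<notin> R"
  proof
    assume "w \<in> R"
    moreover have "last xs \<in> graph_component E (hd xs)"
      using xs(1) by (intro successively_in_graph_component) (auto simp: S_def xs_eq)
    ultimately have "w = last xs"
      using root_forest_roots_disconnected[OF P] R xs(1) by (auto simp: S_def xs_eq)
    then show False using xs(1) by (auto simp: S_def xs_eq split: if_splits)
  qed
  moreover have "z = p" if z: "{w, z} \<in> E" for z
  proof -
    have zw: "z \<in> V" "z \<noteq> w" using edge[OF z] by auto
    \<comment> \<open>A neighbour of \<open>w\<close> off the path would extend it beyond the
      maximal length.\<close>
    have "z \<in> set xs"
    proof (rule ccontr)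
      assume "z \<notin> set xs"
      then have "S (z # xs)" using xs(1) z zw by (auto simp: S_def xs_eq insert_commute)
      then show False using xs(2) by fastforce
    qed
    then obtain k where k: "k < length xs" "z = xs ! k" by (auto simp: in_set_conv_nth)
    have k0: "k \<noteq> 0" using k zw by (metis nth_Cons_0 xs_eq)
    \<comment> \<open>For \<open>k \<ge> 2\<close> the edge from \<open>xs ! k\<close> back to
      \<open>w = xs ! 0\<close> closes the first \<open>k + 1\<close> vertices of the path to a
      cycle. This leaves \<open>k = 1\<close>, the position of \<open>p\<close>.\<close>
    have "k < 2"
    proof (rule ccontr)
      assume k2: "\<not> k < 2"
      have step: "{xs ! i, xs ! Suc i} \<in> E" if "Suc i < length xs" for i
        using xs(1) that by (auto simp: S_def successively_conv_nth)
      have "{xs ! k, xs ! 0} \<in> E" using z k(2) by (simp add: xs_eq insert_commute)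
      then have "{take (Suc k) xs ! i, take (Suc k) xs ! (Suc i mod Suc k)} \<in> E" if "i < Suc k" for i
        using that k(1) step[of i] by (cases "i = k") auto
      then have "is_cycle E (take (Suc k) xs)"
        using k(1) k2 xs(1) unfolding is_cycle_def by (simp add: S_def min_absorb2)
      then show False using nc by blast
    qed
    then show ?thesis using k k0 by (auto simp: xs_eq less_2_cases_iff)
  qed
  moreover have "\<exists>z. e = {w, z}" if "e \<in> E" "w \<in> e" for e
    using g that by (auto simp: graph_on_def card_2_iff)
  ultimately have "{e \<in> E. w \<in> e} = {{w, p}}" using wp by blast
  then have "vertex_degree E w = 1" by (simp add: vertex_degree_def)
  then show ?thesis using w \<open>w \<notin> R\<close> by blast
qed

section \<open>Counting forests and words with a given degree sequence\<close>

definition degree_forests :: "'a set \<Rightarrow> 'a set \<Rightarrow> ('a \<Rightarrow> nat) \<Rightarrow> 'a set set set" where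
  "degree_forests V R d = {E. root_forest V R E \<and> (\<forall>v\<in>V. vertex_degree E v = d v)}"

text \<open>These are the possible Pruefer codes of the forests in
  \<open>degree_forests V R d\<close>. A non-root has one edge besides those to its children, the
  edge towards its root; hence the summand 1. For \<open>V = R\<close> the word is empty and has no
  last letter.\<close>

definition degree_codes :: "'a set \<Rightarrow> 'a set \<Rightarrow> ('a \<Rightarrow> nat) \<Rightarrow> 'a list set" where
  "degree_codes V R d = {xs. set xs \<subseteq> V \<and> length xs = card (V - R) \<and> (xs \<noteq> [] \<longrightarrow> last xs \<in> R) \<and>
     (\<forall>v\<in>V. count_list xs v + (if v \<in> R then 0 else 1) = d v)}"

lemma finite_degree_forests: "finite V \<Longrightarrow> finite (degree_forests V R d)"
  by (rule finite_subset[of _ "Pow (Pow V)"])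
    (auto simp: degree_forests_def root_forest_def is_forest_def graph_on_def)

lemma finite_degree_codes: "finite V \<Longrightarrow> finite (degree_codes V R d)"
  by (rule finite_subset[OF _ finite_lists_length_eq[of V "card (V - R)"]])
    (auto simp: degree_codes_def)

lemma vertex_degree_insert_edge:
  assumes "finite E" "e \<notin> E"
  shows "vertex_degree (insert e E) x = (if x \<in> e then Suc (vertex_degree E x) else vertex_degree E x)"
proof -
  have "{f \<in> insert e E. x \<in> f} = (if x \<in> e then insert e {f \<in> E. x \<in> f} else {f \<in> E. x \<in> f})"
    by auto
  then show ?thesis using assms by (auto simp: vertex_degree_def)
qed

text \<open>Sorts the forests by the unique neighbour \<open>u\<close> of the leaf \<open>v\<close>.
  The condition \<open>0 < d u\<close> keeps the truncated subtraction \<open>d u - 1\<close>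
  faithful.\<close>

lemma card_degree_forests_rec:
  assumes fin: "finite V" and R: "R \<subseteq> V" and v: "v \<in> V - R" and dv: "d v = 1"
  shows "card (degree_forests V R d) =
    (\<Sum>u\<in>{u \<in> V - {v}. 0 < d u}. card (degree_forests (V - {v}) R (d(u := d u - 1))))"
proof -
  let ?U = "{u \<in> V - {v}. 0 < d u}"
  let ?A = "\<lambda>u. degree_forests (V - {v}) R (d(u := d u - 1))"
  have A: "v \<notin> e" if "E \<in> ?A u" "e \<in> E" for u E e
    using that by (auto simp: degree_forests_def root_forest_def is_forest_def graph_on_def)
  have finA: "finite E" if "E \<in> ?A u" for u E
    using that fin finite_graph_on[of "V - {v}" E]
    by (auto simp: degree_forests_def root_forest_def is_forest_def)
  have "bij_betw (\<lambda>(u, E). insert {u, v} E) (SIGMA u:?U. ?A u) (degree_forests V R d)"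
  proof (rule bij_betwI')
    fix p q assume p: "p \<in> (SIGMA u:?U. ?A u)" and q: "q \<in> (SIGMA u:?U. ?A u)"
    obtain u E where [simp]: "p = (u, E)" by (cases p)
    obtain u' E' where [simp]: "q = (u', E')" by (cases q)
    have E: "\<forall>e\<in>E. v \<notin> e" "\<forall>e\<in>E'. v \<notin> e" using p q A by auto
    have "p = q" if eq: "insert {u, v} E = insert {u', v} E'"
    proof -
      \<comment> \<open>The edge at \<open>v\<close> can be read off from the union, and the
        remaining edges are those that avoid \<open>v\<close>.\<close>
      have "{u, v} = {u', v}" using E eq by blast
      then have "u = u'" by (auto simp: doubleton_eq_iff)
      moreover have "E = {e \<in> insert {u, v} E. v \<notin> e}" "E' = {e \<in> insert {u', v} E'. v \<notin> e}"
        using E by auto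
      ultimately show ?thesis using eq by (metis \<open>p = (u, E)\<close> \<open>q = (u', E')\<close>)
    qed
    then show "((case p of (u, E) \<Rightarrow> insert {u, v} E) = (case q of (u, E) \<Rightarrow> insert {u, v} E))
      = (p = q)" by auto
  next
    fix p assume p: "p \<in> (SIGMA u:?U. ?A u)"
    obtain u E where [simp]: "p = (u, E)" by (cases p)
    have u: "u \<in> V" "u \<noteq> v" "0 < d u" and E: "E \<in> ?A u" using p by auto
    have "root_forest (insert v (V - {v})) R (insert {u, v} E)"
      using E u v R by (intro root_forest_add_leaf) (auto simp: degree_forests_def)
    then have "root_forest V R (insert {u, v} E)" using v by (simp add: insert_absorb)
    moreover have "vertex_degree (insert {u, v} E) x = d x" if x: "x \<in> V" for x
    proof -
      have "{u, v} \<notin> E" using A[OF E] by auto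
      moreover have "{e \<in> E. v \<in> e} = {}" using A[OF E] by blast
      then have "vertex_degree E v = 0" by (simp only: vertex_degree_def card.empty)
      moreover have "vertex_degree E x = (d(u := d u - 1)) x" if "x \<noteq> v"
        using E x that by (auto simp: degree_forests_def)
      ultimately show ?thesis
        using vertex_degree_insert_edge[OF finA[OF E], of "{u, v}" x] u dv
        by (cases "x = v") auto
    qed
    ultimately show "(case p of (u, E) \<Rightarrow> insert {u, v} E) \<in> degree_forests V R d"
      by (auto simp: degree_forests_def)
  next
    fix E assume E: "E \<in> degree_forests V R d"
    then have "root_forest V R E" "vertex_degree E v = 1"
      and deg: "\<And>x. x \<in> V \<Longrightarrow> vertex_degree E x = d x"
      using v dv by (auto simp: degree_forests_def)
    then obtain u E' where u: "u \<in> V - {v}" and E': "E = insert {u, v} E'" "\<forall>e\<in>E'. v \<notin> e"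
      "root_forest (V - {v}) R E'"
      using root_forest_remove_leaf[of V R E v] v R by blast
    have fE': "finite E'"
      using E'(3) fin finite_graph_on[of "V - {v}" E'] by (auto simp: root_forest_def is_forest_def)
    have *: "d x = (if x \<in> {u, v} then Suc (vertex_degree E' x) else vertex_degree E' x)"
      if "x \<in> V" for x
    proof -
      have "{u, v} \<notin> E'" using E'(2) by auto
      then show ?thesis
        using deg[OF that] vertex_degree_insert_edge[OF fE', of "{u, v}" x] E'(1) by simp
    qed
    have "0 < d u" using *[of u] u by auto
    moreover have "E' \<in> ?A u" using * E'(3) u by (auto simp: degree_forests_def)
    ultimately have "(u, E') \<in> (SIGMA u:?U. ?A u)" using u by auto
    then show "\<exists>p\<in>(SIGMA u:?U. ?A u). E = (case p of (u, E) \<Rightarrow> insert {u, v} E)"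
      using E'(1) by (intro bexI[of _ "(u, E')"]) auto
  qed
  then have "card (degree_forests V R d) = card (SIGMA u:?U. ?A u)"
    by (rule bij_betw_same_card[symmetric])
  also have "\<dots> = (\<Sum>u\<in>?U. card (?A u))"
    using fin by (subst card_SigmaI) (auto intro: finite_degree_forests)
  finally show ?thesis .
qed

text \<open>Sorts the words by their first letter \<open>u\<close>. A non-root \<open>v\<close> with
  \<open>d v = 1\<close> does not occur in the word, so the rest is a word over
  \<open>V - {v}\<close>, shorter by one just as there is one non-root less.\<close>

lemma card_degree_codes_rec:
  assumes fin: "finite V" and R: "R \<subseteq> V" and v: "v \<in> V - R" and dv: "d v = 1"
  shows "card (degree_codes V R d) =
    (\<Sum>u\<in>{u \<in> V - {v}. 0 < d u}. card (degree_codes (V - {v}) R (d(u := d u - 1))))"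
proof -
  let ?U = "{u \<in> V - {v}. 0 < d u}"
  let ?A = "\<lambda>u. degree_codes (V - {v}) R (d(u := d u - 1))"
  have VR: "card (V - R) = Suc (card (V - {v} - R))"
  proof -
    have "V - R = insert v (V - {v} - R)" using v by auto
    then show ?thesis using fin by (metis Diff_iff card_insert_disjoint finite_Diff insertI1)
  qed
  have "bij_betw (\<lambda>(u, xs). u # xs) (SIGMA u:?U. ?A u) (degree_codes V R d)"
  proof (rule bij_betwI')
    fix p assume p: "p \<in> (SIGMA u:?U. ?A u)"
    obtain u xs where [simp]: "p = (u, xs)" by (cases p)
    have u: "u \<in> V" "u \<noteq> v" "0 < d u" and xs: "xs \<in> ?A u" using p by auto
    have vxs: "v \<notin> set xs" using xs by (auto simp: degree_codes_def)
    \<comment> \<open>In this case \<open>u\<close> becomes the last letter. An empty rest means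
      that \<open>v\<close> was the only non-root, so \<open>u\<close> is a root.\<close>
    have "u \<in> R" if "xs = []"
    proof -
      have "V - {v} - R = {}" using xs that fin by (auto simp: degree_codes_def)
      then show ?thesis using u by auto
    qed
    moreover have "count_list (u # xs) x + (if x \<in> R then 0 else 1) = d x" if x: "x \<in> V" for x
    proof (cases "x = v")
      case True
      then show ?thesis using vxs u v dv by simp
    next
      case False
      then have "count_list xs x + (if x \<in> R then 0 else 1) = (d(u := d u - 1)) x"
        using xs x by (auto simp: degree_codes_def)
      then show ?thesis using u by (auto split: if_splits)
    qed
    ultimately have "u # xs \<in> degree_codes V R d"
      using xs u VR by (auto simp: degree_codes_def)
    then show "(case p of (u, xs) \<Rightarrow> u # xs) \<in> degree_codes V R d" by simp
  next
    fix ys assume ys: "ys \<in> degree_codes V R d"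
    then obtain u xs where ux: "ys = u # xs"
      using VR by (cases ys) (auto simp: degree_codes_def)
    have cnt: "count_list (u # xs) x + (if x \<in> R then 0 else 1) = d x" if "x \<in> V" for x
      using ys that unfolding degree_codes_def ux by blast
    \<comment> \<open>The summand 1 for the non-root \<open>v\<close> already exhausts
      \<open>d v = 1\<close>.\<close>
    have "v \<notin> set (u # xs)"
      using cnt[of v] v dv by (auto simp: count_list_0_iff split: if_splits)
    moreover have "set ys \<subseteq> V" using ys by (auto simp: degree_codes_def)
    ultimately have u: "u \<in> V" "u \<noteq> v" and xsV: "set xs \<subseteq> V - {v}" by (auto simp: ux)
    have "0 < d u" using cnt[OF u(1)] by (auto split: if_splits)
    moreover have "count_list xs x + (if x \<in> R then 0 else 1) = (d(u := d u - 1)) x"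
      if "x \<in> V - {v}" for x
      using cnt[of x] that by (auto split: if_splits)
    then have "xs \<in> ?A u"
      using ys xsV VR by (auto simp: degree_codes_def ux split: if_splits)
    ultimately show "\<exists>p\<in>(SIGMA u:?U. ?A u). ys = (case p of (u, xs) \<Rightarrow> u # xs)"
      using u by (intro bexI[of _ "(u, xs)"]) (auto simp: ux)
  qed auto
  then have "card (degree_codes V R d) = card (SIGMA u:?U. ?A u)"
    by (rule bij_betw_same_card[symmetric])
  also have "\<dots> = (\<Sum>u\<in>?U. card (?A u))"
    using fin by (subst card_SigmaI) (auto intro: finite_degree_codes)
  finally show ?thesis .
qed

text \<open>Otherwise every non-root occurs in the word, and not as its last letter, which is a
  root. Then \<open>card (V - R)\<close> different letters would have to fit into one place
  fewer.\<close>

lemma degree_codes_leaf_exists: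
  assumes fin: "finite V" and R: "R \<subset> V" and xs: "xs \<in> degree_codes V R d"
  shows "\<exists>v\<in>V - R. d v = 1"
proof (rule ccontr)
  assume no: "\<not> ?thesis"
  have len: "length xs = card (V - R)" and lastR: "xs \<noteq> [] \<longrightarrow> last xs \<in> R"
    and cnt: "\<And>v. v \<in> V \<Longrightarrow> count_list xs v + (if v \<in> R then 0 else 1) = d v"
    using xs by (auto simp: degree_codes_def)
  have pos: "0 < card (V - R)" using fin R by (auto simp: card_gt_0_iff)
  have ne: "xs \<noteq> []" using pos len by auto
  have "V - R \<subseteq> set (butlast xs)"
  proof
    fix v assume v: "v \<in> V - R"
    then have "d v \<noteq> 1" using no by blast
    then have "count_list xs v \<noteq> 0" using cnt[of v] v by auto
    then have "v \<in> set xs" by (simp add: count_list_0_iff)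
    moreover have "v \<noteq> last xs" using lastR ne v by auto
    moreover have "set xs = insert (last xs) (set (butlast xs))"
      using arg_cong[OF append_butlast_last_id[OF ne], of set] by auto
    ultimately show "v \<in> set (butlast xs)" by auto
  qed
  then have "card (V - R) \<le> card (set (butlast xs))" by (intro card_mono) auto
  also have "\<dots> \<le> length xs - 1" using card_length[of "butlast xs"] by simp
  finally show False using len pos by simp
qed

text \<open>Induction on the number of non-roots, for all \<open>d\<close> at once since the
  recursion changes \<open>d\<close>. If some non-root has \<open>d v = 1\<close>, both recursions
  apply to the same \<open>v\<close>; if none has, both sets are empty.\<close>

lemma card_degree_forests_eq_card_degree_codes:
  assumes "finite V" "R \<subseteq> V"
  shows "card (degree_forests V R d) = card (degree_codes V R d)"
  using assms
proof (induction "card (V - R)" arbitrary: V d)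
  case 0
  then have VR: "V = R" by auto
  \<comment> \<open>If all vertices are roots, an edge would put two roots into one
    component.\<close>
  have "E = {}" if "root_forest R R E" for E
  proof -
    have "e \<notin> E" for e
    proof
      assume e: "e \<in> E"
      then have "card e = 2" "e \<subseteq> R"
        using that by (auto simp: root_forest_def is_forest_def graph_on_def)
      then obtain a b where ab: "e = {a, b}" "a \<noteq> b" "a \<in> R" "b \<in> R"
        by (auto simp: card_2_iff)
      then show False
        using root_forest_roots_disconnected[OF that _ ab(3,4)] graph_component_edge[of a b E] e
        by auto
    qed
    then show ?thesis by auto
  qed
  moreover have "\<not> is_cycle {} c" for c :: "'a list"
    by (auto simp: is_cycle_def intro!: exI[of _ 0])
  then have "root_forest R R {}"
    by (auto simp: root_forest_def is_forest_def graph_on_def graph_component_def)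
  ultimately have "root_forest R R E \<longleftrightarrow> E = {}" for E by blast
  then have "degree_forests V R d = (if \<forall>v\<in>V. d v = 0 then {{}} else {})"
    unfolding degree_forests_def VR by (auto simp: vertex_degree_def)
  moreover have "degree_codes V R d = (if \<forall>v\<in>V. d v = 0 then {[]} else {})"
    by (auto simp: degree_codes_def VR)
  ultimately show ?case by simp
next
  case (Suc m)
  then have R: "R \<subset> V" by auto
  show ?case
  proof (cases "\<exists>v\<in>V - R. d v = 1")
    case True
    then obtain v where v: "v \<in> V - R" "d v = 1" by blast
    have "V - {v} - R = V - R - {v}" by auto
    then have "m = card (V - {v} - R)" using Suc.hyps(2) v(1) by simp
    then have "card (degree_forests (V - {v}) R d') = card (degree_codes (V - {v}) R d')" for d'
      using Suc.prems v by (intro Suc.hyps(1)) auto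
    then show ?thesis
      using card_degree_forests_rec[of V R v d] card_degree_codes_rec[of V R v d] Suc.prems v by simp
  next
    case False
    then have "degree_codes V R d = {}"
      using degree_codes_leaf_exists[OF Suc.prems(1) R] by blast
    moreover have "degree_forests V R d = {}"
      using root_forest_leaf_exists[OF _ Suc.prems(1) R] False by (fastforce simp: degree_forests_def)
    ultimately show ?thesis by simp
  qed
qed

section \<open>The class of forests as rooted forests\<close>

lemma forests_eq_root_forest:
  assumes "t \<le> n"
  shows "forests n t = {E. root_forest {1..n} {1..t} E}"
proof -
  have "card (graph_components {1..n} E) = t \<and>
     (\<forall>i\<in>{1..t}. \<forall>j\<in>{1..t}. i \<noteq> j \<longrightarrow> graph_component E i \<noteq> graph_component E j) \<longleftrightarrow>
     (\<forall>v\<in>{1..n}. \<exists>!r. r \<in> {1..t} \<and> r \<in> graph_component E v)" (is "?L \<longleftrightarrow> ?R") for E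
  proof -
    let ?C = "graph_component E"
    have sub: "?C ` {1..t} \<subseteq> ?C ` {1..n}" using assms by auto
    have inj: "inj_on ?C {1..t} \<longleftrightarrow> (\<forall>i\<in>{1..t}. \<forall>j\<in>{1..t}. i \<noteq> j \<longrightarrow> ?C i \<noteq> ?C j)"
      by (auto simp: inj_on_def)
    \<comment> \<open>Different components for the roots already make \<open>t\<close> components,
      so a total of \<open>t\<close> says that every component is the component of a root.\<close>
    have "?L \<longleftrightarrow> inj_on ?C {1..t} \<and> ?C ` {1..n} = ?C ` {1..t}"
      using card_image[of ?C "{1..t}"] card_subset_eq[OF _ sub]
      unfolding graph_components_def inj[symmetric] by auto
    also have "\<dots> \<longleftrightarrow> ?R"
    proof
      assume L: "inj_on ?C {1..t} \<and> ?C ` {1..n} = ?C ` {1..t}"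
      show ?R
      proof
        fix v assume "v \<in> {1..n}"
        then have "?C v \<in> ?C ` {1..t}" using L by blast
        then obtain r where r: "r \<in> {1..t}" "?C v = ?C r" by blast
        show "\<exists>!r. r \<in> {1..t} \<and> r \<in> ?C v"
        proof (rule ex1I[of _ r])
          show "r \<in> {1..t} \<and> r \<in> ?C v" using r self_in_graph_component[of r E] by simp
        next
          fix s assume s: "s \<in> {1..t} \<and> s \<in> ?C v"
          then have "?C r = ?C s" using r(2) graph_component_eq_iff[of E v s] by simp
          then show "s = r" using L r(1) s by (metis inj_onD)
        qed
      qed
    next
      assume R: ?R
      have "inj_on ?C {1..t}"
      proof (rule inj_onI)
        fix i j assume ij: "i \<in> {1..t}" "j \<in> {1..t}" "?C i = ?C j"
        moreover have "i \<in> {1..n}" using ij assms by auto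
        ultimately show "i = j" using R self_in_graph_component[of _ E] by metis
      qed
      moreover have "?C v \<in> ?C ` {1..t}" if "v \<in> {1..n}" for v
        using R that graph_component_eq_iff[of E v] by (metis imageI)
      ultimately show "inj_on ?C {1..t} \<and> ?C ` {1..n} = ?C ` {1..t}" using sub by blast
    qed
    finally show ?thesis .
  qed
  then show ?thesis by (auto simp: forests_def root_forest_def)
qed

section \<open>From equal counts to equal distributions\<close>

text \<open>The probability of \<open>y\<close> is the size of its fibre divided by the size of the
  whole set, and the whole size is the sum of the fibre sizes.\<close>

lemma map_pmf_of_set_cong_card:
  assumes A: "finite A" "A \<noteq> {}" and B: "finite B" "B \<noteq> {}"
    and card: "\<And>y. card {x \<in> A. f x = y} = card {x \<in> B. g x = y}"
  shows "map_pmf f (pmf_of_set A) = map_pmf g (pmf_of_set B)"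
proof -
  have img: "f ` A = g ` B"
  proof -
    have "y \<in> f ` A \<longleftrightarrow> card {x \<in> A. f x = y} \<noteq> 0" for y using A by auto
    moreover have "y \<in> g ` B \<longleftrightarrow> card {x \<in> B. g x = y} \<noteq> 0" for y using B by auto
    ultimately show ?thesis using card by (intro set_eqI) simp
  qed
  have "card A = (\<Sum>y\<in>f ` A. card {x \<in> A. f x = y})"
    using sum.image_gen[OF A(1), of "\<lambda>_. 1::nat" f] by simp
  also have "\<dots> = (\<Sum>y\<in>g ` B. card {x \<in> B. g x = y})" by (simp add: img card)
  also have "\<dots> = card B"
    using sum.image_gen[OF B(1), of "\<lambda>_. 1::nat" g] by simp
  finally have AB: "card A = card B" .
  show ?thesis
  proof (rule pmf_eqI)
    fix y
    have "A \<inter> f -` {y} = {x \<in> A. f x = y}" "B \<inter> g -` {y} = {x \<in> B. g x = y}" by auto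
    then show "pmf (map_pmf f (pmf_of_set A)) y = pmf (map_pmf g (pmf_of_set B)) y"
      using A B card[of y] AB by (simp add: pmf_map measure_pmf_of_set)
  qed
qed

lemma pair_pmf_of_set:
  assumes "finite A" "A \<noteq> {}" "finite B" "B \<noteq> {}"
  shows "pair_pmf (pmf_of_set A) (pmf_of_set B) = pmf_of_set (A \<times> B)"
proof (rule pmf_eqI)
  fix p
  show "pmf (pair_pmf (pmf_of_set A) (pmf_of_set B)) p = pmf (pmf_of_set (A \<times> B)) p"
    using assms by (cases p) (simp add: pmf_pair card_cartesian_product indicator_def)
qed

lemma count_list_map_upt: "count_list (map b [1..<Suc m]) j = load m b j"
proof -
  have "count_list (map b [1..<Suc m]) j = length (filter (\<lambda>i. b i = j) [1..<Suc m])"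
    by (simp add: count_list_eq_length_filter filter_map o_def eq_commute)
  also have "\<dots> = card (set (filter (\<lambda>i. b i = j) [1..<Suc m]))"
    by (rule distinct_card[symmetric]) simp
  also have "set (filter (\<lambda>i. b i = j) [1..<Suc m]) = {i \<in> {1..m}. b i = j}" by auto
  finally show ?thesis by (simp add: load_def)
qed

lemma map_upt_eq_iff: "map f [1..<n+1] = xs \<longleftrightarrow> length xs = n \<and> (\<forall>j\<in>{1..n}. f j = xs ! (j - 1))"
proof
  assume "length xs = n \<and> (\<forall>j\<in>{1..n}. f j = xs ! (j - 1))"
  then show "map f [1..<n+1] = xs" by (intro nth_equalityI) (auto simp del: upt_Suc)
qed (auto simp del: upt_Suc)

theorem theorem6p2:
  fixes n t :: nat
  assumes "1 \<le> t" and "t < n"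
  shows "map_pmf (degree_sequence n) (pmf_of_set (forests n t)) =
    map_pmf
      (\<lambda>(b, R). let Z = load (n - t - 1) b; X = (\<lambda>j. if R = j then 1 else 0) in
         map (\<lambda>j. Z j + X j) [1..<t+1] @ map (\<lambda>j. Z j + 1) [t+1..<n+1])
      (pair_pmf (throw_balls (n - t - 1) n) (pmf_of_set {1..t}))"
    (is "_ = map_pmf ?g _")
proof -
  define m where "m = n - t - 1"
  \<comment> \<open>The equally likely throws: maps from balls to bins, with the default
    \<open>undefined\<close> outside \<open>{1..m}\<close>.\<close>
  let ?D = "PiE_dflt {1..m} undefined (\<lambda>_. {1..n})"
  let ?B = "?D \<times> {1..t}"
  have finD: "finite ?D" by (intro finite_PiE_dflt) auto
  have neD: "?D \<noteq> {}" using assms by (auto simp: PiE_dflt_empty_iff)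
  have pair: "pair_pmf (throw_balls (n - t - 1) n) (pmf_of_set {1..t}) = pmf_of_set ?B"
    using assms finD neD unfolding throw_balls_def m_def[symmetric]
    by (subst Pi_pmf_of_set) (auto intro!: pair_pmf_of_set)
  have B: "finite ?B" "?B \<noteq> {}" using finD neD assms by simp_all
  have counts: "card {E \<in> forests n t. degree_sequence n E = d} = card {p \<in> ?B. ?g p = d}" for d
  proof (cases "length d = n")
    case False
    then have "degree_sequence n E \<noteq> d" "?g p \<noteq> d" for E p
      using assms by (auto simp: degree_sequence_def Let_def split: prod.splits)
    then show ?thesis by simp
  next
    case True
    \<comment> \<open>Vertices are numbered from 1, list positions from 0.\<close>
    let ?d = "\<lambda>j. d ! (j - 1)"
    have "{E \<in> forests n t. degree_sequence n E = d} = degree_forests {1..n} {1..t} ?d"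
      unfolding degree_forests_def degree_sequence_def map_upt_eq_iff
      using assms True by (auto simp: forests_eq_root_forest)
    \<comment> \<open>The bins of the \<open>m\<close> balls, followed by the value of
      \<open>R\<close>, form the word.\<close>
    moreover have "bij_betw (\<lambda>(b, r). map b [1..<Suc m] @ [r]) {p \<in> ?B. ?g p = d}
      (degree_codes {1..n} {1..t} ?d)"
    proof -
      have "{1..n} - {1..t} = {t<..n}" by auto
      \<comment> \<open>There are \<open>m + 1\<close> non-roots, matching \<open>m\<close> letters
        from the balls and one last letter from \<open>R\<close>.\<close>
      then have card: "card ({1..n} - {1..t}) = Suc m" using assms by (simp add: m_def)
      have code: "map b [1..<Suc m] @ [r] \<in> degree_codes {1..n} {1..t} ?d \<longleftrightarrow> ?g (b, r) = d"
        if "(b, r) \<in> ?B" for b r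
      proof -
        have "b i \<in> {1..n}" if "i \<in> {1..m}" for i
          using that \<open>(b, r) \<in> ?B\<close> by (auto simp: PiE_dflt_def)
        then have s: "set (map b [1..<Suc m] @ [r]) \<subseteq> {1..n}"
          using that assms by (auto simp del: upt_Suc)
        have r: "r \<in> {1..t}" using that by auto
        \<comment> \<open>Among the roots, \<open>X j\<close> counts the last letter. The other
          vertices do not occur as last letter, and their constant 1 is the non-root summand in
          \<open>degree_codes\<close>.\<close>
        have "[1..<n+1] = [1..<t+1] @ [t+1..<n+1]"
          using assms upt_add_eq_append[of 1 "t+1" "n-t"] by (simp del: upt_Suc)
        then have "?g (b, r) = map (\<lambda>j. count_list (map b [1..<Suc m] @ [r]) j +
            (if j \<in> {1..t} then 0 else 1)) [1..<n+1]"
          using r unfolding count_list_append count_list_map_upt m_def[symmetric]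
          by (auto simp: Let_def simp del: upt_Suc)
        then have "?g (b, r) = d \<longleftrightarrow> (\<forall>j\<in>{1..n}. count_list (map b [1..<Suc m] @ [r]) j +
            (if j \<in> {1..t} then 0 else 1) = ?d j)"
          using True by (simp only: map_upt_eq_iff simp_thms)
        moreover have "length (map b [1..<Suc m] @ [r]) = Suc m" by simp
        ultimately show ?thesis
          using s r unfolding degree_codes_def card mem_Collect_eq last_snoc by blast
      qed
      show ?thesis
      proof (rule bij_betwI')
        fix p q assume p: "p \<in> {p \<in> ?B. ?g p = d}" and q: "q \<in> {p \<in> ?B. ?g p = d}"
        obtain b r b' r' where [simp]: "p = (b, r)" "q = (b', r')" by (cases p, cases q)
        \<comment> \<open>The word fixes \<open>b\<close> on \<open>{1..m}\<close>; elsewhere both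
          maps take the default value.\<close>
        have "b = b'" if "map b [1..<Suc m] = map b' [1..<Suc m]"
        proof
          fix i
          show "b i = b' i"
          proof (cases "i \<in> {1..m}")
            case True
            then show ?thesis using that by (auto simp: map_eq_conv simp del: upt_Suc)
          next
            case False
            then show ?thesis using p q by (auto simp: PiE_dflt_def)
          qed
        qed
        then show "((case p of (b, r) \<Rightarrow> map b [1..<Suc m] @ [r]) =
          (case q of (b, r) \<Rightarrow> map b [1..<Suc m] @ [r])) = (p = q)"
          by (auto simp del: upt_Suc)
      next
        fix p assume "p \<in> {p \<in> ?B. ?g p = d}"
        then show "(case p of (b, r) \<Rightarrow> map b [1..<Suc m] @ [r]) \<in> degree_codes {1..n} {1..t} ?d"
          using code by (cases p) (auto simp del: upt_Suc)
      next
        fix xs assume xs: "xs \<in> degree_codes {1..n} {1..t} ?d"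
        then have len: "length xs = Suc m" and set: "set xs \<subseteq> {1..n}" and l: "last xs \<in> {1..t}"
          using card by (auto simp: degree_codes_def)
        \<comment> \<open>The throw read off from the word; the value \<open>undefined\<close>
          elsewhere puts it into \<open>?D\<close>.\<close>
        define b where "b i = (if i \<in> {1..m} then xs ! (i - 1) else undefined)" for i
        have "xs ! (i - 1) \<in> {1..n}" if "i \<in> {1..m}" for i
          using set len that nth_mem[of "i - 1" xs] by (auto simp: subset_iff)
        then have B: "(b, last xs) \<in> ?B" using l by (auto simp: PiE_dflt_def b_def)
        have "map b [1..<Suc m] = butlast xs"
          using len by (intro nth_equalityI) (auto simp: b_def nth_butlast simp del: upt_Suc)
        then have eq: "xs = map b [1..<Suc m] @ [last xs]"
          using len by (metis append_butlast_last_id list.size(3) nat.simps(3))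
        then have "?g (b, last xs) = d" using code[OF B] xs by simp
        then show "\<exists>p\<in>{p \<in> ?B. ?g p = d}. xs = (case p of (b, r) \<Rightarrow> map b [1..<Suc m] @ [r])"
          using B eq by (intro bexI[of _ "(b, last xs)"]) (auto simp del: upt_Suc)
      qed
    qed
    then have "card {p \<in> ?B. ?g p = d} = card (degree_codes {1..n} {1..t} ?d)"
      by (rule bij_betw_same_card)
    moreover have "card (degree_forests {1..n} {1..t} ?d) = card (degree_codes {1..n} {1..t} ?d)"
      using assms by (intro card_degree_forests_eq_card_degree_codes) auto
    ultimately show ?thesis by simp
  qed
  show ?thesis
    unfolding pair
    by (rule map_pmf_of_set_cong_card[OF finite_forests forests_nonempty[OF assms] B counts])
qed

end
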